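(* Let $g\in L^2(\mathbb{R}^d)$ be a nonnegative function supported on a bounded set $\Omega$ of positive Lebesgue measure with $g>0$ a.e. on $\Omega$, and let $\Lambda,\mathcal{J}\subset\mathbb{R}^d$ be discrete sets. Suppose $\mathcal{G}(g,\Lambda,\mathcal{J})$ is an orthonormal basis of $L^2(\mathbb{R}^d)$. Then: (i) $\mathcal{J}$ is a tiling set of $\Omega$; (ii) $g=\mathcal{L}(\Omega)^{-1/2}\chi_\Omega$ a.e.; (iii) $\{e_\lambda:\lambda\in\Lambda\}$ is an orthogonal basis of $L^2(\Omega)$ (equivalently, $\Lambda$ is a spectrum for the normalized Lebesgue measure $\mathcal{L}(\Omega)^{-1}\chi_\Omega\,dx$).
   Context: $e_\lambda(x)=e^{2\pi i\lambda\cdot x}$; $\mathcal{L}$ is Lebesgue measure. Gabor system: $\mathcal{G}(g,\Lambda,\mathcal{J})=\{e^{2\pi i\lambda\cdot x}g(x-p):\lambda\in\Lambda,p\in\mathcal{J}\}$. $\mathcal{J}$ is a tiling set of $\Omega$ if $\bigcup_{t\in\mathcal{J}}(\Omega+t)$ covers $\mathbb{R}^d$ up to a Lebesgue-null set and $\mathcal{L}((\Omega+t)\cap(\Omega+t'))=0$ for distinct $t,t'\in\mathcal{J}$. A set $\Lambda$ is a spectrum of a probability measure $\mu$ if $\{e_\lambda:\lambda\in\Lambda\}$ is an orthonormal basis of $L^2(\mu)$. *)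

theory Defs
  imports "HOL-Analysis.Analysis"
begin

definition expo :: "'a::euclidean_space \<Rightarrow> 'a \<Rightarrow> complex" where
  "expo l x = exp (2 * pi * \<i> * complex_of_real (l \<bullet> x))"

definition sq_integrable :: "'a measure \<Rightarrow> ('a \<Rightarrow> complex) \<Rightarrow> bool" where
  "sq_integrable M f \<longleftrightarrow> f \<in> borel_measurable M \<and> integrable M (\<lambda>x. (cmod (f x))\<^sup>2)"

definition L2_inner :: "'a measure \<Rightarrow> ('a \<Rightarrow> complex) \<Rightarrow> ('a \<Rightarrow> complex) \<Rightarrow> complex" where
  "L2_inner M f h = (LINT x|M. f x * cnj (h x))"

definition L2_orthonormal_basis :: "'a measure \<Rightarrow> 'i set \<Rightarrow> ('i \<Rightarrow> 'a \<Rightarrow> complex) \<Rightarrow> bool" where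
  "L2_orthonormal_basis M I u \<longleftrightarrow>
     (\<forall>i\<in>I. sq_integrable M (u i)) \<and>
     (\<forall>i\<in>I. \<forall>j\<in>I. L2_inner M (u i) (u j) = (if i = j then 1 else 0)) \<and>
     (\<forall>f. sq_integrable M f \<and> (\<forall>i\<in>I. L2_inner M f (u i) = 0) \<longrightarrow> (AE x in M. f x = 0))"

definition L2_orthogonal_basis :: "'a measure \<Rightarrow> 'i set \<Rightarrow> ('i \<Rightarrow> 'a \<Rightarrow> complex) \<Rightarrow> bool" where
  "L2_orthogonal_basis M I u \<longleftrightarrow>
     (\<forall>i\<in>I. sq_integrable M (u i) \<and> \<not> (AE x in M. u i x = 0)) \<and>
     (\<forall>i\<in>I. \<forall>j\<in>I. i \<noteq> j \<longrightarrow> L2_inner M (u i) (u j) = 0) \<and>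
     (\<forall>f. sq_integrable M f \<and> (\<forall>i\<in>I. L2_inner M f (u i) = 0) \<longrightarrow> (AE x in M. f x = 0))"

definition gabor :: "('a::euclidean_space \<Rightarrow> real) \<Rightarrow> 'a \<times> 'a \<Rightarrow> 'a \<Rightarrow> complex" where
  "gabor g = (\<lambda>(l, p) x. expo l x * complex_of_real (g (x - p)))"

definition tiling_set :: "'a::euclidean_space set \<Rightarrow> 'a set \<Rightarrow> bool" where
  "tiling_set \<Omega> J \<longleftrightarrow>
     (UNIV - (\<Union>t\<in>J. (\<lambda>x. x + t) ` \<Omega>)) \<in> null_sets lebesgue \<and>
     (\<forall>t\<in>J. \<forall>t'\<in>J. t \<noteq> t' \<longrightarrow>
        ((\<lambda>x. x + t) ` \<Omega> \<inter> (\<lambda>x. x + t') ` \<Omega>) \<in> null_sets lebesgue)"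

end

theory Submission
  imports Defs
begin

text \<open>
  Since \<open>g \<ge> 0\<close>, orthogonality of two translates of \<open>g\<close> forces their supports to be disjoint, and completeness
  of the system forces the translates of \<open>\<Omega>\<close> to cover the space. Within a single tile, Parseval's identity says that
  \<open>\<integral> \<bar>F\<bar>\<^sup>2 / g\<^sup>2\<close> is determined by the numbers \<open>\<bar>\<integral> F(x) e\<^sub>-\<^sub>\<lambda>(x) dx\<bar>\<close>, \<open>\<lambda> \<in> \<Lambda>\<close>, which do not change when \<open>F\<close> is translated.
  Hence, for every \<open>a\<close>, \<open>g(x) = g(x + a)\<close> for almost all \<open>x \<in> \<Omega> \<inter> (\<Omega> - a)\<close>, and by Fubini's theorem \<open>g\<close> is constant
  on \<open>\<Omega>\<close>. The constant is fixed by \<open>\<parallel>g\<parallel> = 1\<close>, and dividing by it turns the elements supported on one tile into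
  exponentials.
\<close>

subsection \<open>Parseval's identity\<close>

lemma countable_discrete:
  fixes S :: "'a :: second_countable_topology set"
  assumes "discrete S" shows "countable S"
proof -
  from ex_countable_basis obtain B :: "'a set set"
    where B: "countable B" "topological_basis B" by blast
  have "\<exists>U. U \<in> B \<and> U \<inter> S = {x}" if x: "x \<in> S" for x
  proof -
    from discreteD[OF assms x] obtain T where T: "open T" "T \<inter> S = {x}"
      unfolding isolated_in_def by (elim exE conjE)
    have "x \<in> T" using T(2) by blast
    then obtain U where U: "U \<in> B" "x \<in> U" "U \<subseteq> T"
      by (rule topological_basisE[OF B(2) T(1)])
    have "U \<inter> S = {x}" using U(2,3) T(2) x by blast
    with U(1) show ?thesis by (intro exI conjI)
  qed
  then have "\<forall>x\<in>S. \<exists>U. U \<in> B \<and> U \<inter> S = {x}" by (intro ballI)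
  from bchoice[OF this] obtain h where h: "\<forall>x\<in>S. h x \<in> B \<and> h x \<inter> S = {x}" by (elim exE)
  have inj: "inj_on h S"
  proof (rule inj_onI)
    fix x y assume xy: "x \<in> S" "y \<in> S" "h x = h y"
    have "{x} = h x \<inter> S" using conjunct2[OF bspec[OF h xy(1)]] by (rule sym)
    also have "\<dots> = h y \<inter> S" by (simp only: xy(3))
    also have "\<dots> = {y}" using bspec[OF h xy(2)] by (rule conjunct2)
    finally show "x = y" by (rule singleton_inject)
  qed
  have "countable (h ` S)"
    by (rule countable_subset[OF image_subsetI B(1)]) (rule conjunct1[OF bspec[OF h]])
  from this inj show ?thesis by (rule countable_image_inj_on)
qed

lemma sq_integrable_measurable: "sq_integrable M f \<Longrightarrow> f \<in> borel_measurable M"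
  by (simp add: sq_integrable_def)

lemma sq_integrable_mult:
  assumes "sq_integrable M f" "sq_integrable M h"
  shows "integrable M (\<lambda>x. f x * cnj (h x))"
proof (rule Bochner_Integration.integrable_bound)
  show "integrable M (\<lambda>x. (cmod (f x))\<^sup>2 + (cmod (h x))\<^sup>2)"
    using assms by (simp add: sq_integrable_def)
  have "cnj \<in> borel_measurable borel"
    by (intro borel_measurable_continuous_onI continuous_intros)
  then have "(\<lambda>x. cnj (h x)) \<in> borel_measurable M"
    by (rule measurable_compose[OF sq_integrable_measurable[OF assms(2)]])
  then show "(\<lambda>x. f x * cnj (h x)) \<in> borel_measurable M"
    using sq_integrable_measurable[OF assms(1)] by (intro borel_measurable_times)
  have "a * b \<le> a\<^sup>2 + b\<^sup>2" if "0 \<le> a" "0 \<le> b" for a b :: real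
  proof -
    have "2 * (a * b) \<le> a\<^sup>2 + b\<^sup>2" using sum_squares_bound[of a b] by simp
    moreover have "0 \<le> a * b" using that by simp
    ultimately show ?thesis by linarith
  qed
  then show "AE x in M. norm (f x * cnj (h x)) \<le> norm ((cmod (f x))\<^sup>2 + (cmod (h x))\<^sup>2)"
    by (simp add: norm_mult)
qed

lemma sq_integrable_add:
  assumes "sq_integrable M f" "sq_integrable M h"
  shows "sq_integrable M (\<lambda>x. f x + h x)"
  unfolding sq_integrable_def
proof (rule conjI[OF _ Bochner_Integration.integrable_bound])
  have m: "f \<in> borel_measurable M" "h \<in> borel_measurable M"
    using assms by (auto simp: sq_integrable_def)
  show "integrable M (\<lambda>x. 2 * (cmod (f x))\<^sup>2 + 2 * (cmod (h x))\<^sup>2)"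
    using assms by (simp add: sq_integrable_def)
  show "(\<lambda>x. f x + h x) \<in> borel_measurable M" "(\<lambda>x. (cmod (f x + h x))\<^sup>2) \<in> borel_measurable M"
    by (use m in measurable)
  have "(cmod (a + b))\<^sup>2 \<le> 2 * (cmod a)\<^sup>2 + 2 * (cmod b)\<^sup>2" for a b
  proof -
    have "(cmod (a + b))\<^sup>2 \<le> (cmod a + cmod b)\<^sup>2"
      by (intro power_mono norm_triangle_ineq norm_ge_zero)
    also have "\<dots> \<le> 2 * (cmod a)\<^sup>2 + 2 * (cmod b)\<^sup>2"
      using sum_squares_bound[of "cmod a" "cmod b"] by (simp add: power2_sum)
    finally show ?thesis .
  qed
  then show "AE x in M. norm ((cmod (f x + h x))\<^sup>2) \<le> norm (2 * (cmod (f x))\<^sup>2 + 2 * (cmod (h x))\<^sup>2)"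
    by simp
qed

lemma sq_integrable_cmult: "sq_integrable M f \<Longrightarrow> sq_integrable M (\<lambda>x. c * f x)"
  by (auto simp: sq_integrable_def norm_mult power_mult_distrib)

lemma sq_integrable_diff:
  "sq_integrable M f \<Longrightarrow> sq_integrable M h \<Longrightarrow> sq_integrable M (\<lambda>x. f x - h x)"
  using sq_integrable_add[of M f "\<lambda>x. -1 * h x"] sq_integrable_cmult[of M h "-1"] by simp

lemma sq_integrable_sum:
  "(\<And>i. i \<in> A \<Longrightarrow> sq_integrable M (f i)) \<Longrightarrow> sq_integrable M (\<lambda>x. \<Sum>i\<in>A. f i x)"
  by (induction A rule: infinite_finite_induct) (auto intro: sq_integrable_add simp: sq_integrable_def[of _ "\<lambda>_. 0"])

lemma L2_inner_self: "L2_inner M f f = complex_of_real (LINT x|M. (cmod (f x))\<^sup>2)"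
  unfolding L2_inner_def by (simp add: complex_norm_square[symmetric] flip: of_real_power)

lemma L2_inner_commute: "L2_inner M f h = cnj (L2_inner M h f)"
  unfolding L2_inner_def Bochner_Integration.integral_cnj[symmetric] by (simp add: mult.commute)

lemma L2_inner_diff:
  assumes "sq_integrable M f" "sq_integrable M h" "sq_integrable M k"
  shows "L2_inner M (\<lambda>x. f x - h x) k = L2_inner M f k - L2_inner M h k"
  using assms by (simp add: L2_inner_def left_diff_distrib sq_integrable_mult)

lemma L2_inner_sum:
  assumes "\<And>i. i \<in> A \<Longrightarrow> sq_integrable M (f i)" "sq_integrable M h"
  shows "L2_inner M (\<lambda>x. \<Sum>i\<in>A. c i * f i x) h = (\<Sum>i\<in>A. c i * L2_inner M (f i) h)"
  using assms by (simp add: L2_inner_def sum_distrib_right mult.assoc sq_integrable_mult)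

lemma L2_orthonormal_basisD:
  assumes "L2_orthonormal_basis M I u"
  shows "i \<in> I \<Longrightarrow> sq_integrable M (u i)"
    and "i \<in> I \<Longrightarrow> j \<in> I \<Longrightarrow> L2_inner M (u i) (u j) = (if i = j then 1 else 0)"
    and "sq_integrable M f \<Longrightarrow> (\<And>i. i \<in> I \<Longrightarrow> L2_inner M f (u i) = 0) \<Longrightarrow> AE x in M. f x = 0"
  using assms by (simp_all add: L2_orthonormal_basis_def)

lemma sq_integrable_basis_sum:
  assumes "L2_orthonormal_basis M I u" "A \<subseteq> I"
  shows "sq_integrable M (\<lambda>x. \<Sum>i\<in>A. c i * u i x)"
  using assms unfolding L2_orthonormal_basis_def
  by (intro sq_integrable_sum sq_integrable_cmult) auto

lemma L2_inner_basis_sum: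
  assumes "L2_orthonormal_basis M I u" "finite A" "A \<subseteq> I" "j \<in> I"
  shows "L2_inner M (\<lambda>x. \<Sum>i\<in>A. c i * u i x) (u j) = (if j \<in> A then c j else 0)"
proof -
  have "L2_inner M (\<lambda>x. \<Sum>i\<in>A. c i * u i x) (u j) = (\<Sum>i\<in>A. c i * L2_inner M (u i) (u j))"
    using assms by (intro L2_inner_sum) (auto simp: L2_orthonormal_basis_def)
  also have "\<dots> = (\<Sum>i\<in>A. if i = j then c i else 0)"
    using assms by (intro sum.cong) (auto simp: L2_orthonormal_basis_def)
  finally show ?thesis using assms by simp
qed

lemma L2_norm_basis_sum:
  assumes "L2_orthonormal_basis M I u" "finite A" "A \<subseteq> I"
  shows "(LINT x|M. (cmod (\<Sum>i\<in>A. c i * u i x))\<^sup>2) = (\<Sum>i\<in>A. (cmod (c i))\<^sup>2)"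
proof -
  let ?s = "\<lambda>x. \<Sum>i\<in>A. c i * u i x"
  have "L2_inner M ?s ?s = (\<Sum>i\<in>A. c i * L2_inner M (u i) ?s)"
    using assms by (intro L2_inner_sum sq_integrable_basis_sum) (auto simp: L2_orthonormal_basis_def)
  also have "\<dots> = (\<Sum>i\<in>A. c i * cnj (c i))"
    using assms(3) L2_inner_basis_sum[OF assms]
    by (intro sum.cong refl, subst L2_inner_commute) auto
  also have "\<dots> = complex_of_real (\<Sum>i\<in>A. (cmod (c i))\<^sup>2)"
    by (simp only: of_real_sum complex_norm_square)
  finally show ?thesis
    unfolding L2_inner_self of_real_eq_iff .
qed

lemma L2_norm_residual:
  assumes B: "L2_orthonormal_basis M I u" and A: "finite A" "A \<subseteq> I" and f: "sq_integrable M f"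
  shows "(LINT x|M. (cmod (f x - (\<Sum>i\<in>A. L2_inner M f (u i) * u i x)))\<^sup>2) =
    (LINT x|M. (cmod (f x))\<^sup>2) - (\<Sum>i\<in>A. (cmod (L2_inner M f (u i)))\<^sup>2)"
proof -
  let ?s = "\<lambda>x. \<Sum>i\<in>A. L2_inner M f (u i) * u i x"
  have s: "sq_integrable M ?s" by (rule sq_integrable_basis_sum[OF B A(2)])
  have u: "\<And>i. i \<in> A \<Longrightarrow> sq_integrable M (u i)" using B A by (auto simp: L2_orthonormal_basis_def)
  have r: "sq_integrable M (\<lambda>x. f x - ?s x)" by (rule sq_integrable_diff[OF f s])
  have orth: "L2_inner M ?s (\<lambda>x. f x - ?s x) = 0"
  proof -
    have "L2_inner M (u i) (\<lambda>x. f x - ?s x) = 0" if "i \<in> A" for i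
      using L2_inner_diff[OF f s u[OF that]] L2_inner_basis_sum[OF B A, of i] that A
        L2_inner_commute[of M "u i" "\<lambda>x. f x - ?s x"] by auto
    then show ?thesis by (subst L2_inner_sum[OF u r]) auto
  qed
  have "L2_inner M (\<lambda>x. f x - ?s x) (\<lambda>x. f x - ?s x) = L2_inner M f (\<lambda>x. f x - ?s x)"
    using L2_inner_diff[OF f s r] orth by simp
  also have "\<dots> = cnj (L2_inner M f f - L2_inner M ?s f)"
    using L2_inner_commute[of M f "\<lambda>x. f x - ?s x"] L2_inner_diff[OF f s f] by simp
  also have "L2_inner M ?s f = (\<Sum>i\<in>A. L2_inner M f (u i) * cnj (L2_inner M f (u i)))"
    by (subst L2_inner_sum[OF u f]) (auto simp flip: L2_inner_commute[of M _ f])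
  also have "\<dots> = complex_of_real (\<Sum>i\<in>A. (cmod (L2_inner M f (u i)))\<^sup>2)"
    by (simp only: of_real_sum complex_norm_square)
  finally show ?thesis
    unfolding L2_inner_self of_real_diff[symmetric] complex_cnj_complex_of_real of_real_eq_iff .
qed

lemma L2_Bessel:
  assumes "L2_orthonormal_basis M I u" "finite A" "A \<subseteq> I" "sq_integrable M f"
  shows "(\<Sum>i\<in>A. (cmod (L2_inner M f (u i)))\<^sup>2) \<le> (LINT x|M. (cmod (f x))\<^sup>2)"
  using L2_norm_residual[OF assms] Bochner_Integration.integral_nonneg
    [of M "\<lambda>x. (cmod (f x - (\<Sum>i\<in>A. L2_inner M f (u i) * u i x)))\<^sup>2"] by simp

lemma L2_fast_Cauchy_limit:
  assumes s: "\<And>k. sq_integrable M (s k)"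
    and fast: "\<And>k m. k \<le> m \<Longrightarrow> (LINT x|M. (cmod (s m x - s k x))\<^sup>2) \<le> (1/4) ^ k"
  obtains f where "sq_integrable M f" "\<And>k. (LINT x|M. (cmod (s k x - f x))\<^sup>2) \<le> (1/4) ^ k"
proof -
  have s_meas [measurable]: "s k \<in> borel_measurable M" for k
    by (rule sq_integrable_measurable[OF s])
  have d: "integrable M (\<lambda>x. (cmod (s m x - s k x))\<^sup>2)" for k m
    using sq_integrable_diff[OF s s, of m k] by (simp add: sq_integrable_def)
  have d': "(\<integral>\<^sup>+x. ennreal ((cmod (s m x - s k x))\<^sup>2) \<partial>M) \<le> ennreal ((1/4) ^ k)" if "k \<le> m" for k m
    using fast[OF that] by (subst nn_integral_eq_integral[OF d]) (auto intro: ennreal_leI)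
  let ?G = "\<lambda>x. \<Sum>k. ennreal (2 ^ k * (cmod (s (Suc k) x - s k x))\<^sup>2)"
  have "(\<integral>\<^sup>+x. ?G x \<partial>M) = (\<Sum>k. \<integral>\<^sup>+x. ennreal (2 ^ k * (cmod (s (Suc k) x - s k x))\<^sup>2) \<partial>M)"
    by (intro nn_integral_suminf) measurable
  also have "\<dots> \<le> (\<Sum>k. ennreal ((1/2) ^ k))"
  proof (intro suminf_le summableI)
    fix k
    have "(\<integral>\<^sup>+x. ennreal (2 ^ k * (cmod (s (Suc k) x - s k x))\<^sup>2) \<partial>M)
        = ennreal (2 ^ k) * (\<integral>\<^sup>+x. ennreal ((cmod (s (Suc k) x - s k x))\<^sup>2) \<partial>M)"
      by (subst nn_integral_cmult[symmetric]) (auto simp: ennreal_mult)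
    also have "\<dots> \<le> ennreal (2 ^ k) * ennreal ((1/4) ^ k)"
      by (intro mult_left_mono d') auto
    also have "\<dots> = ennreal ((1/2) ^ k)"
      by (simp add: ennreal_mult[symmetric] power_mult_distrib[symmetric])
    finally show "(\<integral>\<^sup>+x. ennreal (2 ^ k * (cmod (s (Suc k) x - s k x))\<^sup>2) \<partial>M) \<le> ennreal ((1/2) ^ k)" .
  qed
  also have "\<dots> = ennreal (\<Sum>k. (1/2) ^ k)"
    by (intro suminf_ennreal2) (auto intro: summable_geometric)
  also have "\<dots> < \<infinity>" by simp
  finally have "AE x in M. ?G x \<noteq> \<infinity>"
    by (intro nn_integral_PInf_AE) auto
  then have conv: "AE x in M. convergent (\<lambda>k. s k x)"
  proof eventually_elim
    fix x assume "?G x \<noteq> \<infinity>"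
    then have "summable (\<lambda>k. 2 ^ k * (cmod (s (Suc k) x - s k x))\<^sup>2)"
      unfolding infinity_ennreal_def by (rule summable_suminf_not_top[rotated]) simp
    then have "Bseq (\<lambda>k. 2 ^ k * (cmod (s (Suc k) x - s k x))\<^sup>2)"
      by (intro convergent_imp_Bseq convergentI[OF summable_LIMSEQ_zero])
    then obtain K where "K > 0" "\<forall>k. norm (2 ^ k * (cmod (s (Suc k) x - s k x))\<^sup>2) \<le> K"
      by (rule BseqE)
    then have K: "K > 0" "\<And>k. 2 ^ k * (cmod (s (Suc k) x - s k x))\<^sup>2 \<le> K"
      by simp_all
    have le: "cmod (s (Suc k) x - s k x) \<le> sqrt K * (1 / sqrt 2) ^ k" for k
    proof (rule power2_le_imp_le)
      have "(cmod (s (Suc k) x - s k x))\<^sup>2 \<le> K / 2 ^ k"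
        using K(2)[of k] by (simp add: field_simps)
      also have "\<dots> = (sqrt K * (1 / sqrt 2) ^ k)\<^sup>2"
        using K(1) by (simp add: power_mult_distrib power_divide real_sqrt_power[symmetric])
      finally show "(cmod (s (Suc k) x - s k x))\<^sup>2 \<le> (sqrt K * (1 / sqrt 2) ^ k)\<^sup>2" .
    qed (use K in auto)
    have "summable (\<lambda>k. sqrt K * (1 / sqrt 2) ^ k)"
      by (intro summable_mult summable_geometric) simp
    then have "summable (\<lambda>k. s (Suc k) x - s k x)"
      by (rule summable_comparison_test') (rule le)
    then obtain L where "(\<lambda>n. \<Sum>k<n. s (Suc k) x - s k x) \<longlonglongrightarrow> L"
      by (auto dest: summable_LIMSEQ)
    from tendsto_add[OF this tendsto_const[of "s 0 x"]]
    have "(\<lambda>n. s n x) \<longlonglongrightarrow> L + s 0 x"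
      unfolding sum_lessThan_telescope[of "\<lambda>k. s k x"] by simp
    then show "convergent (\<lambda>n. s n x)" by (rule convergentI)
  qed
  define f where "f x = lim (\<lambda>k. s k x)" for x
  have [measurable]: "f \<in> borel_measurable M" unfolding f_def by measurable
  have bound: "(\<integral>\<^sup>+x. ennreal ((cmod (s k x - f x))\<^sup>2) \<partial>M) \<le> ennreal ((1/4) ^ k)" for k
  proof -
    have "(\<integral>\<^sup>+x. ennreal ((cmod (s k x - f x))\<^sup>2) \<partial>M)
        = (\<integral>\<^sup>+x. liminf (\<lambda>m. ennreal ((cmod (s m x - s k x))\<^sup>2)) \<partial>M)"
    proof (rule nn_integral_cong_AE, use conv in eventually_elim)
      case (elim x)
      then have "(\<lambda>m. s m x) \<longlonglongrightarrow> f x" by (simp add: convergent_LIMSEQ_iff f_def)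
      then have "(\<lambda>m. ennreal ((cmod (s m x - s k x))\<^sup>2)) \<longlonglongrightarrow> ennreal ((cmod (f x - s k x))\<^sup>2)"
        by (intro tendsto_ennrealI tendsto_power tendsto_norm tendsto_diff tendsto_const)
      from lim_imp_Liminf[OF _ this] show ?case by (simp add: norm_minus_commute[of "f x"])
    qed
    also have "\<dots> \<le> liminf (\<lambda>m. \<integral>\<^sup>+x. ennreal ((cmod (s m x - s k x))\<^sup>2) \<partial>M)"
      by (intro nn_integral_liminf) measurable
    also have "\<dots> \<le> ennreal ((1/4) ^ k)"
      by (rule Liminf_le) (auto intro!: eventually_sequentiallyI[of k] d')
    finally show ?thesis .
  qed
  have sf: "sq_integrable M (\<lambda>x. s k x - f x)" for k
    unfolding sq_integrable_def
  proof (intro conjI integrableI_bounded)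
    show "(\<integral>\<^sup>+x. ennreal (norm ((cmod (s k x - f x))\<^sup>2)) \<partial>M) < \<infinity>"
      using le_less_trans[OF bound[of k], of \<infinity>] by simp
  qed measurable
  show ?thesis
  proof
    show "sq_integrable M f"
      using sq_integrable_diff[OF s sf, of 0 0] by simp
    show "(LINT x|M. (cmod (s k x - f x))\<^sup>2) \<le> (1/4) ^ k" for k
      using bound[of k] sf[of k] by (subst (asm) nn_integral_eq_integral) (auto simp: sq_integrable_def)
  qed
qed

text \<open>The partial sums of the expansion of \<open>f\<close> converge by completeness, and maximality of the system
  forces the limit to be \<open>f\<close>.\<close>

lemma L2_Parseval:
  assumes B: "L2_orthonormal_basis M I u" and f: "sq_integrable M f"
  shows "(LINT x|M. (cmod (f x))\<^sup>2) =
    (SUP A\<in>{A. finite A \<and> A \<subseteq> I}. \<Sum>i\<in>A. (cmod (L2_inner M f (u i)))\<^sup>2)"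
proof -
  define c where "c i = L2_inner M f (u i)" for i
  define S where "S A = (\<Sum>i\<in>A. (cmod (c i))\<^sup>2)" for A
  define F where "F = {A. finite A \<and> A \<subseteq> I}"
  define N where "N = (LINT x|M. (cmod (f x))\<^sup>2)"
  define T where "T = (SUP A\<in>F. S A)"
  define s where "s A x = (\<Sum>i\<in>A. c i * u i x)" for A x
  have u: "sq_integrable M (u i)" if "i \<in> I" for i
    using B that by (simp add: L2_orthonormal_basis_def)
  have F0: "{} \<in> F" by (simp add: F_def)
  have bess: "S A \<le> N" if "A \<in> F" for A
    using L2_Bessel[OF B _ _ f, of A] that by (simp add: F_def S_def c_def N_def)
  then have bdd: "bdd_above (S ` F)" by (rule bdd_aboveI2)
  have ST: "S A \<le> T" if "A \<in> F" for A
    unfolding T_def by (rule cSUP_upper[OF that bdd])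
  have TN: "T \<le> N"
    unfolding T_def by (rule cSUP_least) (use F0 bess in auto)
  have "\<exists>A\<in>F. T - (1/4) ^ k < S A" for k :: nat
    using less_cSUP_iff[OF _ bdd, of "T - (1/4) ^ k"] F0 by (auto simp: T_def)
  then obtain A0 where A0: "\<And>k. A0 k \<in> F" "\<And>k::nat. T - (1/4) ^ k < S (A0 k)"
    by metis
  define A where "A k = (\<Union>j\<le>k. A0 j)" for k
  have A: "A k \<in> F" for k using A0(1) by (auto simp: A_def F_def)
  have A_mono: "A k \<subseteq> A m" if "k \<le> m" for k m unfolding A_def using that by (intro UN_mono) auto
  have A_large: "T - (1/4) ^ k < S (A k)" for k
  proof -
    have "S (A0 k) \<le> S (A k)"
      unfolding S_def using A[of k] by (intro sum_mono2) (auto simp: A_def F_def)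
    with A0(2)[of k] show ?thesis by simp
  qed
  have s_int: "sq_integrable M (s (A k))" for k
    unfolding s_def using A[of k] by (intro sq_integrable_basis_sum[OF B]) (simp add: F_def)
  have "(LINT x|M. (cmod (s (A m) x - s (A k) x))\<^sup>2) \<le> (1/4) ^ k" if "k \<le> m" for k m
  proof -
    have fin: "finite (A m)" "A m \<subseteq> I" using A[of m] by (auto simp: F_def)
    have "s (A m) x - s (A k) x = (\<Sum>i\<in>A m - A k. c i * u i x)" for x
      by (simp only: s_def sum_diff[OF fin(1) A_mono[OF that]])
    then have "(LINT x|M. (cmod (s (A m) x - s (A k) x))\<^sup>2) = S (A m - A k)"
      using L2_norm_basis_sum[OF B, of "A m - A k" c] fin by (auto simp: S_def)
    also have "\<dots> = S (A m) - S (A k)"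
      by (simp only: S_def sum_diff[OF fin(1) A_mono[OF that]])
    also have "\<dots> \<le> (1/4) ^ k" using ST[OF A[of m]] A_large[of k] by simp
    finally show ?thesis .
  qed
  from L2_fast_Cauchy_limit[OF s_int this] obtain h where h: "sq_integrable M h"
    and hs: "\<And>k. (LINT x|M. (cmod (s (A k) x - h x))\<^sup>2) \<le> (1/4) ^ k" by blast
  have "L2_inner M (\<lambda>x. f x - h x) (u i) = 0" if i: "i \<in> I" for i
  proof -
    let ?z = "L2_inner M (\<lambda>x. f x - h x) (u i)"
    have bound: "cmod ?z \<le> 2 * (1/2) ^ k" for k
    proof -
      have fk: "finite (A k)" "A k \<subseteq> I" using A[of k] by (auto simp: F_def)
      have ck: "L2_inner M (s (A k)) (u i) = (if i \<in> A k then c i else 0)"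
        unfolding s_def by (rule L2_inner_basis_sum[OF B fk i])
      have "(cmod (c i - L2_inner M (s (A k)) (u i)))\<^sup>2 \<le> (1/4) ^ k"
      proof (cases "i \<in> A k")
        case False
        have "insert i (A k) \<in> F" using A[of k] i by (auto simp: F_def)
        from ST[OF this] False fk(1) A_large[of k] show ?thesis by (simp add: ck S_def)
      qed (simp add: ck)
      also have "\<dots> = ((1/2) ^ k)\<^sup>2" by (simp add: power2_eq_square power_mult_distrib[symmetric])
      finally have 1: "cmod (c i - L2_inner M (s (A k)) (u i)) \<le> (1/2) ^ k"
        by (rule power2_le_imp_le) simp
      have "(cmod (L2_inner M (\<lambda>x. s (A k) x - h x) (u i)))\<^sup>2 \<le> (1/4) ^ k"
        using L2_Bessel[OF B, of "{i}", OF _ _ sq_integrable_diff[OF s_int h]] i hs[of k]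
        by (auto intro: order_trans)
      also have "\<dots> = ((1/2) ^ k)\<^sup>2" by (simp add: power2_eq_square power_mult_distrib[symmetric])
      finally have 2: "cmod (L2_inner M (\<lambda>x. s (A k) x - h x) (u i)) \<le> (1/2) ^ k"
        by (rule power2_le_imp_le) simp
      have "?z = (c i - L2_inner M (s (A k)) (u i)) + L2_inner M (\<lambda>x. s (A k) x - h x) (u i)"
        by (simp add: L2_inner_diff f h s_int u[OF i] c_def)
      then show ?thesis using 1 2 norm_triangle_ineq[of "c i - L2_inner M (s (A k)) (u i)"
            "L2_inner M (\<lambda>x. s (A k) x - h x) (u i)"] by simp
    qed
    have lim: "(\<lambda>k. 2 * (1/2) ^ k :: real) \<longlonglongrightarrow> 2 * 0"
      by (intro tendsto_mult tendsto_const LIMSEQ_power_zero) simp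
    have "cmod ?z \<le> 2 * 0" by (rule LIMSEQ_le_const[OF lim]) (intro exI allI impI bound)
    then show ?thesis by simp
  qed
  then have fh: "AE x in M. f x - h x = 0"
    by (intro L2_orthonormal_basisD(3)[OF B] sq_integrable_diff[OF f h])
  have "N - S (A k) \<le> (1/4) ^ k" for k
  proof -
    have "N - S (A k) = (LINT x|M. (cmod (f x - s (A k) x))\<^sup>2)"
      using L2_norm_residual[OF B _ _ f, of "A k"] A[of k]
      by (simp add: N_def S_def c_def s_def F_def)
    also have "\<dots> = (LINT x|M. (cmod (s (A k) x - h x))\<^sup>2)"
    proof (rule integral_cong_AE)
      show "AE x in M. (cmod (f x - s (A k) x))\<^sup>2 = (cmod (s (A k) x - h x))\<^sup>2"
        using fh by eventually_elim (simp add: norm_minus_commute)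
      show "(\<lambda>x. (cmod (f x - s (A k) x))\<^sup>2) \<in> borel_measurable M"
        using sq_integrable_diff[OF f s_int[of k]] by (auto simp: sq_integrable_def)
      show "(\<lambda>x. (cmod (s (A k) x - h x))\<^sup>2) \<in> borel_measurable M"
        using sq_integrable_diff[OF s_int[of k] h] by (auto simp: sq_integrable_def)
    qed
    finally show ?thesis using hs[of k] by simp
  qed
  then have NT: "N - T \<le> (1/4) ^ k" for k using ST[OF A[of k]] by (meson diff_mono order_refl order_trans)
  have "(\<lambda>k. (1/4) ^ k :: real) \<longlonglongrightarrow> 0" by (rule LIMSEQ_power_zero) simp
  then have "N - T \<le> 0" by (rule LIMSEQ_le_const) (intro exI allI impI NT)
  with TN have "N = T" by simp
  then show ?thesis by (simp add: N_def T_def S_def F_def c_def)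
qed

corollary L2_norm_eq_if_coefficients:
  assumes "L2_orthonormal_basis M I u" "sq_integrable M f" "sq_integrable M h"
    and "\<And>i. i \<in> I \<Longrightarrow> cmod (L2_inner M f (u i)) = cmod (L2_inner M h (u i))"
  shows "(LINT x|M. (cmod (f x))\<^sup>2) = (LINT x|M. (cmod (h x))\<^sup>2)"
  unfolding L2_Parseval[OF assms(1,2)] L2_Parseval[OF assms(1,3)]
  by (intro SUP_cong sum.cong refl arg_cong[where f = "\<lambda>x. x\<^sup>2"]) (use assms(4) in auto)

subsection \<open>Translations\<close>

lemma lebesgue_measurable_translation [measurable]:
  fixes a :: "'a::euclidean_space"
  shows "(\<lambda>x. x + a) \<in> lebesgue \<rightarrow>\<^sub>M lebesgue"
  using lebesgue_affine_measurable[of "\<lambda>_. 1" a] by (simp add: euclidean_representation add.commute)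

lemma distr_lebesgue_translation:
  fixes a :: "'a::euclidean_space"
  shows "distr lebesgue lebesgue (\<lambda>x. x + a) = lebesgue"
  using lebesgue_affine_euclidean[of "\<lambda>_. 1" a]
  by (simp add: euclidean_representation add.commute[of a] density_1)

lemma borel_measurable_lebesgue_translation:
  fixes f :: "'a::euclidean_space \<Rightarrow> 'b::topological_space"
  shows "f \<in> borel_measurable lebesgue \<Longrightarrow> (\<lambda>x. f (x + a)) \<in> borel_measurable lebesgue"
  by (rule measurable_compose[OF lebesgue_measurable_translation])

lemma integral_lebesgue_translation:
  fixes f :: "'a::euclidean_space \<Rightarrow> 'b::{banach, second_countable_topology}"
  assumes "f \<in> borel_measurable lebesgue"
  shows "(LINT x|lebesgue. f (x + a)) = (LINT x|lebesgue. f x)"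
  using integral_distr[OF lebesgue_measurable_translation[of a] assms]
  by (simp only: distr_lebesgue_translation)

lemma integrable_lebesgue_translation:
  fixes f :: "'a::euclidean_space \<Rightarrow> 'b::{banach, second_countable_topology}"
  assumes "integrable lebesgue f"
  shows "integrable lebesgue (\<lambda>x. f (x + a))"
  using integrable_distr[OF lebesgue_measurable_translation[of a], of f] assms
  by (simp only: distr_lebesgue_translation)

lemma AE_lebesgue_translation:
  fixes a :: "'a::euclidean_space"
  assumes "AE x in lebesgue. P x"
  shows "AE x in lebesgue. P (x + a)"
  using AE_distrD[OF lebesgue_measurable_translation[of a], of P] assms
  by (simp only: distr_lebesgue_translation)

lemma sq_integrable_translation:
  fixes a :: "'a::euclidean_space"
  assumes "sq_integrable lebesgue f"
  shows "sq_integrable lebesgue (\<lambda>x. f (x - a))"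
  using assms borel_measurable_lebesgue_translation[of f "- a"]
    integrable_lebesgue_translation[of "\<lambda>x. (cmod (f x))\<^sup>2" "- a"]
  by (simp add: sq_integrable_def)

lemma null_sets_dichotomy_translation:
  fixes A B :: "'a::euclidean_space set"
  assumes sets: "A \<in> sets lebesgue" "B \<in> sets lebesgue"
    and null: "\<And>a. AE x in lebesgue. \<not> (x \<in> A \<and> x + a \<in> B)"
  shows "A \<in> null_sets lebesgue \<or> B \<in> null_sets lebesgue"
proof -
  obtain A1 N1 N1' where A1: "A = A1 \<union> N1" "N1 \<subseteq> N1'" "N1' \<in> null_sets lborel" "A1 \<in> sets lborel"
    using sets(1) by (rule sets_completionE)
  obtain B1 N2 N2' where B1: "B = B1 \<union> N2" "N2 \<subseteq> N2'" "N2' \<in> null_sets lborel" "B1 \<in> sets lborel"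
    using sets(2) by (rule sets_completionE)
  have [measurable]: "A1 \<in> sets borel" "B1 \<in> sets borel" using A1(4) B1(4) by simp_all
  let ?k = "\<lambda>x a. indicator A1 x * indicator B1 (x + a) :: ennreal"
  have "(\<integral>\<^sup>+x. ?k x a \<partial>lborel) = 0" for a
  proof -
    have "AE x in lebesgue. ?k x a = 0"
      using null[of a] by eventually_elim (auto simp: A1(1) B1(1) indicator_def)
    then have "AE x in lborel. ?k x a = 0" by (simp only: AE_completion_iff)
    then show ?thesis by (subst nn_integral_0_iff_AE) auto
  qed
  moreover have "(\<integral>\<^sup>+a. (\<integral>\<^sup>+x. ?k x a \<partial>lborel) \<partial>lborel) = (\<integral>\<^sup>+x. (\<integral>\<^sup>+a. ?k x a \<partial>lborel) \<partial>lborel)"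
    by (rule lborel_pair.Fubini') simp
  moreover have "(\<integral>\<^sup>+a. ?k x a \<partial>lborel) = indicator A1 x * emeasure lborel B1" for x
  proof -
    have "(\<integral>\<^sup>+a. indicator B1 (x + a) \<partial>lborel) = (\<integral>\<^sup>+a. indicator B1 a \<partial>distr lborel borel ((+) x))"
      by (subst nn_integral_distr) auto
    also have "\<dots> = emeasure lborel B1" by (simp add: lborel_distr_plus)
    finally show ?thesis by (subst nn_integral_cmult) auto
  qed
  ultimately have "emeasure lborel A1 * emeasure lborel B1 = 0"
    by (simp add: nn_integral_multc)
  then have "A1 \<in> null_sets lborel \<or> B1 \<in> null_sets lborel"
    using A1(4) B1(4) by (auto simp: null_sets_def)
  then show ?thesis
  proof
    assume "A1 \<in> null_sets lborel"
    then show ?thesis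
      using A1 null_sets_completion_subset[of A "A1 \<union> N1'" lborel] null_sets_completionI[of "A1 \<union> N1'" lborel]
      by auto
  next
    assume "B1 \<in> null_sets lborel"
    then show ?thesis
      using B1 null_sets_completion_subset[of B "B1 \<union> N2'" lborel] null_sets_completionI[of "B1 \<union> N2'" lborel]
      by auto
  qed
qed

lemma sq_integrable_bounded_support:
  fixes f :: "'a::euclidean_space \<Rightarrow> complex"
  assumes f: "f \<in> borel_measurable lebesgue" and S: "S \<in> lmeasurable"
    and bound: "\<And>x. cmod (f x) \<le> C" and supp: "\<And>x. x \<notin> S \<Longrightarrow> f x = 0"
  shows "sq_integrable lebesgue f"
  unfolding sq_integrable_def
proof (rule conjI[OF f Bochner_Integration.integrable_bound])
  have "S \<in> sets lebesgue" "emeasure lebesgue S < \<infinity>"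
    using S fmeasurableD2[OF S] by (auto simp: less_top)
  then have "integrable lebesgue (indicator S :: _ \<Rightarrow> real)"
    by (rule integrable_real_indicator)
  then show "integrable lebesgue (\<lambda>x. C\<^sup>2 * indicator S x :: real)"
    by (rule integrable_mult_right)
  show "(\<lambda>x. (cmod (f x))\<^sup>2) \<in> borel_measurable lebesgue"
    using f by measurable
  show "AE x in lebesgue. norm ((cmod (f x))\<^sup>2) \<le> norm (C\<^sup>2 * indicator S x :: real)"
  proof (rule AE_I2)
    fix x
    show "norm ((cmod (f x))\<^sup>2) \<le> norm (C\<^sup>2 * indicator S x :: real)"
    proof (cases "x \<in> S")
      case True
      then show ?thesis using power_mono[OF bound[of x] norm_ge_zero, of 2] by simp
    qed (simp add: supp)
  qed
qed

subsection \<open>Exponentials\<close>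

lemma cmod_expo [simp]: "cmod (expo l x) = 1"
  by (simp add: expo_def)

lemma expo_add: "expo l (x + y) = expo l x * expo l y"
  by (simp add: expo_def inner_add_right distrib_left exp_add)

lemma expo_mult_cnj: "expo l x * cnj (expo l x) = 1"
  using complex_norm_square[of "expo l x"] by simp

lemma borel_measurable_expo [measurable]:
  fixes l :: "'a::euclidean_space"
  shows "expo l \<in> borel_measurable lebesgue" "(\<lambda>x. cnj (expo l x)) \<in> borel_measurable lebesgue"
proof -
  have "expo l \<in> borel_measurable borel" "(\<lambda>x. cnj (expo l x)) \<in> borel_measurable borel"
    unfolding expo_def by (intro borel_measurable_continuous_onI continuous_intros)+
  then show "expo l \<in> borel_measurable lebesgue" "(\<lambda>x. cnj (expo l x)) \<in> borel_measurable lebesgue"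
    by (simp_all add: measurable_completion)
qed

subsection \<open>Gabor bases with nonnegative window\<close>

locale gabor_basis =
  fixes g :: "'a::euclidean_space \<Rightarrow> real" and \<Omega> \<Lambda> J :: "'a set"
  assumes g_meas: "g \<in> borel_measurable lebesgue"
    and g_sq: "integrable lebesgue (\<lambda>x. (g x)\<^sup>2)"
    and g_nonneg: "\<And>x. g x \<ge> 0"
    and g_supp: "\<And>x. x \<notin> \<Omega> \<Longrightarrow> g x = 0"
    and \<Omega>_meas: "\<Omega> \<in> sets lebesgue"
    and \<Omega>_bdd: "bounded \<Omega>"
    and \<Omega>_pos: "measure lebesgue \<Omega> > 0"
    and g_pos: "AE x in lebesgue. x \<in> \<Omega> \<longrightarrow> g x > 0"
    and ONB: "L2_orthonormal_basis lebesgue (\<Lambda> \<times> J) (gabor g)"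
begin

lemmas onb = L2_orthonormal_basisD[OF ONB]

lemma \<Omega>_lmeasurable: "\<Omega> \<in> lmeasurable"
  by (rule bounded_set_imp_lmeasurable[OF \<Omega>_bdd \<Omega>_meas])

lemma g_meas_translation: "(\<lambda>x. g (x + a)) \<in> borel_measurable lebesgue"
  by (rule borel_measurable_lebesgue_translation[OF g_meas])

lemma sets_translate:
  "A \<in> sets lebesgue \<Longrightarrow> {x::'a. x - p \<in> A} \<in> sets lebesgue"
  using measurable_sets[OF lebesgue_measurable_translation[of "- p"], of A]
  by (simp add: vimage_def)

lemma not_AE_notin_\<Omega>: "\<not> (AE x in lebesgue. x \<notin> \<Omega>)"
proof
  assume "AE x in lebesgue. x \<notin> \<Omega>"
  then have "\<Omega> \<in> null_sets lebesgue" by (simp add: AE_iff_null_sets[OF \<Omega>_meas])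
  then show False using \<Omega>_pos by (simp add: measure_def null_sets_def)
qed

lemma indices_nonempty: obtains l p where "l \<in> \<Lambda>" "p \<in> J"
proof (cases "\<Lambda> \<times> J = {}")
  case True
  have "sq_integrable lebesgue (indicator \<Omega>)"
    using \<Omega>_meas by (intro sq_integrable_bounded_support[OF _ \<Omega>_lmeasurable, of _ 1])
      (auto simp: indicator_def)
  from onb(3)[OF this] True have "AE x in lebesgue. (indicator \<Omega> x :: complex) = 0" by simp
  then have "AE x in lebesgue. x \<notin> \<Omega>" by eventually_elim (auto simp: indicator_def)
  then show ?thesis using not_AE_notin_\<Omega> by simp
qed (use that in auto)

lemma AE_translates_disjoint:
  assumes p: "p \<in> J" "p' \<in> J" "p \<noteq> p'"
  shows "AE x in lebesgue. g (x - p) * g (x - p') = 0"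
proof -
  obtain l where l: "l \<in> \<Lambda>" by (rule indices_nonempty)
  let ?h = "\<lambda>x. g (x - p) * g (x - p')"
  have eq: "gabor g (l, p) x * cnj (gabor g (l, p') x) = complex_of_real (?h x)" for x
  proof -
    have "gabor g (l, p) x * cnj (gabor g (l, p') x)
        = (expo l x * cnj (expo l x)) * complex_of_real (?h x)"
      by (simp add: gabor_def)
    then show ?thesis by (simp only: expo_mult_cnj mult_1)
  qed
  have "integrable lebesgue (\<lambda>x. gabor g (l, p) x * cnj (gabor g (l, p') x))"
    using l p by (intro sq_integrable_mult onb(1)) auto
  then have int: "integrable lebesgue ?h"
    by (simp only: eq complex_of_real_integrable_eq)
  have "L2_inner lebesgue (gabor g (l, p)) (gabor g (l, p')) = 0"
    using onb(2)[of "(l, p)" "(l, p')"] l p by simp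
  then have "(LINT x|lebesgue. ?h x) = 0"
    by (simp only: L2_inner_def eq integral_complex_of_real of_real_eq_0_iff)
  moreover have "AE x in lebesgue. 0 \<le> ?h x"
    by (intro AE_I2 mult_nonneg_nonneg g_nonneg)
  ultimately show ?thesis
    using integral_nonneg_eq_0_iff_AE[OF int] by simp
qed

lemma AE_g_pos_translate: "AE x in lebesgue. x - p \<in> \<Omega> \<longrightarrow> g (x - p) > 0"
  using AE_lebesgue_translation[OF g_pos, of "- p"] by simp

lemma tiling:
  assumes "countable J"
  shows "tiling_set \<Omega> J"
proof -
  have im: "(\<lambda>x. x + p) ` \<Omega> = {x. x - p \<in> \<Omega>}" for p
  proof (intro set_eqI iffI)
    fix x assume "x \<in> {x. x - p \<in> \<Omega>}"
    then show "x \<in> (\<lambda>x. x + p) ` \<Omega>" by (intro image_eqI[of _ _ "x - p"]) auto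
  qed auto
  have im_sets: "(\<lambda>x. x + p) ` \<Omega> \<in> sets lebesgue" for p
    unfolding im by (rule sets_translate[OF \<Omega>_meas])
  define N where "N = UNIV - (\<Union>t\<in>J. (\<lambda>x. x + t) ` \<Omega>)"
  have N: "N \<in> sets lebesgue"
    unfolding N_def using im_sets assms
    by (intro sets.Diff sets.countable_UN'') auto
  have "AE x in lebesgue. x \<notin> N \<inter> cball 0 (real n)" for n
  proof -
    let ?f = "indicator (N \<inter> cball 0 (real n)) :: 'a \<Rightarrow> complex"
    have NB: "N \<inter> cball 0 (real n) \<in> lmeasurable"
      using N by (intro bounded_set_imp_lmeasurable) auto
    have f: "sq_integrable lebesgue ?f"
      using fmeasurableD[OF NB] by (intro sq_integrable_bounded_support[OF _ NB, of _ 1])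
        (auto simp: indicator_def)
    have "L2_inner lebesgue ?f (gabor g i) = 0" if i: "i \<in> \<Lambda> \<times> J" for i
    proof -
      have "?f x * cnj (gabor g i x) = 0" for x
      proof (cases "x \<in> N")
        case True
        then have "x - snd i \<notin> \<Omega>" using i unfolding N_def im by auto
        then show ?thesis by (simp add: gabor_def split_beta g_supp)
      qed simp
      then show ?thesis unfolding L2_inner_def by (intro integral_eq_zero_AE AE_I2)
    qed
    then have "AE x in lebesgue. ?f x = 0" by (intro onb(3)[OF f])
    then show ?thesis
      by eventually_elim (auto simp: indicator_def split: if_splits)
  qed
  then have "AE x in lebesgue. \<forall>n. x \<notin> N \<inter> cball 0 (real n)"
    unfolding AE_all_countable by (intro allI)
  then have "AE x in lebesgue. x \<notin> N"
  proof eventually_elim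
    case (elim x)
    obtain n where "norm x \<le> real n" using real_arch_simple by blast
    with elim show ?case by auto
  qed
  then have "N \<in> null_sets lebesgue" by (simp add: AE_iff_null_sets[OF N])
  moreover have "(\<lambda>x. x + t) ` \<Omega> \<inter> (\<lambda>x. x + t') ` \<Omega> \<in> null_sets lebesgue"
    if t: "t \<in> J" "t' \<in> J" "t \<noteq> t'" for t t'
  proof -
    have "AE x in lebesgue. x \<notin> (\<lambda>x. x + t) ` \<Omega> \<inter> (\<lambda>x. x + t') ` \<Omega>"
      using AE_translates_disjoint[OF t] AE_g_pos_translate[of t] AE_g_pos_translate[of t']
      by eventually_elim (auto simp: im)
    then show ?thesis
      using AE_iff_null_sets[of "(\<lambda>x. x + t) ` \<Omega> \<inter> (\<lambda>x. x + t') ` \<Omega>" lebesgue] im_sets by auto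
  qed
  ultimately show ?thesis unfolding tiling_set_def N_def by blast
qed

lemma coefficient_same:
  assumes F: "F \<in> borel_measurable lebesgue"
  shows "L2_inner lebesgue (\<lambda>x. F (x - p)) (gabor g (l, p)) =
    cnj (expo l p) * (LINT x|lebesgue. F x * cnj (expo l x) * complex_of_real (g x))"
proof -
  let ?k = "\<lambda>x. F x * cnj (expo l (x + p)) * complex_of_real (g x)"
  have m: "(\<lambda>x. cnj (expo l (x + p))) \<in> borel_measurable lebesgue"
    by (rule borel_measurable_lebesgue_translation[OF borel_measurable_expo(2)])
  have "?k \<in> borel_measurable lebesgue"
    using F m g_meas by measurable
  from integral_lebesgue_translation[OF this, of "- p"]
  have "L2_inner lebesgue (\<lambda>x. F (x - p)) (gabor g (l, p)) = (LINT x|lebesgue. ?k x)"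
    by (simp add: L2_inner_def gabor_def mult.assoc)
  also have "\<dots> = (LINT x|lebesgue. cnj (expo l p) * (F x * cnj (expo l x) * complex_of_real (g x)))"
    by (simp add: expo_add ac_simps)
  finally show ?thesis by (simp only: integral_mult_right_zero)
qed

lemma coefficient_other:
  assumes p: "p \<in> J" "p' \<in> J" "p \<noteq> p'" and F: "\<And>x. x \<notin> \<Omega> \<Longrightarrow> F x = 0"
  shows "L2_inner lebesgue (\<lambda>x. F (x - p)) (gabor g (l, p')) = 0"
proof -
  have "AE x in lebesgue. F (x - p) * cnj (gabor g (l, p') x) = 0"
    using AE_translates_disjoint[OF p] AE_g_pos_translate[of p]
    by eventually_elim (use F in \<open>auto simp: gabor_def\<close>)
  then show ?thesis unfolding L2_inner_def by (rule integral_eq_zero_AE)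
qed

lemma L2_norm_eq_of_coefficients:
  assumes F: "sq_integrable lebesgue F" "\<And>x. x \<notin> \<Omega> \<Longrightarrow> F x = 0"
    and H: "sq_integrable lebesgue H" "\<And>x. x \<notin> \<Omega> \<Longrightarrow> H x = 0"
    and eq: "\<And>l. cmod (LINT x|lebesgue. F x * cnj (expo l x) * complex_of_real (g x)) =
      cmod (LINT x|lebesgue. H x * cnj (expo l x) * complex_of_real (g x))"
  shows "(LINT x|lebesgue. (cmod (F x))\<^sup>2) = (LINT x|lebesgue. (cmod (H x))\<^sup>2)"
proof -
  obtain p where p: "p \<in> J" by (rule indices_nonempty)
  have tr: "(LINT x|lebesgue. (cmod (G (x - p)))\<^sup>2) = (LINT x|lebesgue. (cmod (G x))\<^sup>2)"
    if "sq_integrable lebesgue G" for G :: "'a \<Rightarrow> complex"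
    using integral_lebesgue_translation[of "\<lambda>x. (cmod (G x))\<^sup>2" "- p"] that
    by (simp add: sq_integrable_def borel_measurable_integrable)
  have "(LINT x|lebesgue. (cmod (F (x - p)))\<^sup>2) = (LINT x|lebesgue. (cmod (H (x - p)))\<^sup>2)"
  proof (rule L2_norm_eq_if_coefficients[OF ONB])
    show "sq_integrable lebesgue (\<lambda>x. F (x - p))" "sq_integrable lebesgue (\<lambda>x. H (x - p))"
      by (intro sq_integrable_translation F H)+
    fix i assume "i \<in> \<Lambda> \<times> J"
    then obtain l p' where i: "i = (l, p')" "p' \<in> J" by auto
    show "cmod (L2_inner lebesgue (\<lambda>x. F (x - p)) (gabor g i)) =
      cmod (L2_inner lebesgue (\<lambda>x. H (x - p)) (gabor g i))"
    proof (cases "p' = p")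
      case True
      then show ?thesis
        using coefficient_same[of F p l] coefficient_same[of H p l] F(1) H(1) eq[of l]
        by (simp add: i norm_mult sq_integrable_def)
    next
      case False
      then show ?thesis
        using coefficient_other[OF p i(2), of F l] coefficient_other[OF p i(2), of H l] F(2) H(2)
        by (simp add: i)
    qed
  qed
  then show ?thesis by (simp only: tr[OF F(1)] tr[OF H(1)])
qed

text \<open>Translating a function by \<open>a\<close> only changes its coefficients by unimodular factors, so on the part of
  \<open>\<Omega>\<close> that \<open>a\<close> keeps in \<open>\<Omega>\<close> Parseval's identity gives \<open>\<integral> \<bar>F\<bar>\<^sup>2 / g\<^sup>2 = \<integral> \<bar>F\<bar>\<^sup>2 / g(\<cdot> + a)\<^sup>2\<close> for every \<open>F\<close>.\<close>

lemma AE_not_less_translate: "AE x in lebesgue. \<not> (0 < g x \<and> g x < g (x + a))"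
proof -
  have "AE x in lebesgue. \<not> (1 / real (Suc n) \<le> g x \<and> g x < g (x + a))" for n
  proof -
    define E where "E = {x. 1 / real (Suc n) \<le> g x \<and> g x < g (x + a)}"
    have [measurable]: "g \<in> borel_measurable lebesgue" "(\<lambda>x. g (x + a)) \<in> borel_measurable lebesgue"
      by (rule g_meas, rule g_meas_translation)
    have "{x \<in> space lebesgue. 1 / real (Suc n) \<le> g x \<and> g x < g (x + a)} \<in> sets lebesgue"
      by measurable
    then have E [measurable]: "E \<in> sets lebesgue" by (simp add: E_def)
    have E': "{x. x - a \<in> E} \<in> sets lebesgue" by (rule sets_translate[OF E])
    have pos: "0 < 1 / real (Suc n)" by simp
    have in_E: "0 < g x" "g x < g (x + a)" "1 / g x \<le> real (Suc n)" "x \<in> \<Omega>" "x + a \<in> \<Omega>"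
      "1 / g (x + a) \<le> real (Suc n)" if "x \<in> E" for x
    proof -
      from that have x: "1 / real (Suc n) \<le> g x" "g x < g (x + a)" by (auto simp: E_def)
      then show *: "0 < g x" "g x < g (x + a)" using pos by linarith+
      have **: "1 / real (Suc n) \<le> g (x + a)" using x by linarith
      show "1 / g x \<le> real (Suc n)" "1 / g (x + a) \<le> real (Suc n)"
        using le_imp_inverse_le[OF x(1) pos] le_imp_inverse_le[OF ** pos]
        by (simp_all add: inverse_eq_divide)
      show "x \<in> \<Omega>" using g_supp[of x] * by force
      show "x + a \<in> \<Omega>" using g_supp[of "x + a"] * by force
    qed
    define F where "F x = complex_of_real (if x \<in> E then 1 / g x else 0)" for x
    define H where "H x = complex_of_real (if x - a \<in> E then 1 / g x else 0)" for x
    have F: "sq_integrable lebesgue F"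
    proof (rule sq_integrable_bounded_support[OF _ \<Omega>_lmeasurable, of _ "real (Suc n)"])
      have "(\<lambda>x. if x \<in> E then 1 / g x else 0) \<in> borel_measurable lebesgue"
        using E by measurable
      then show "F \<in> borel_measurable lebesgue" unfolding F_def by measurable
      show "cmod (F x) \<le> real (Suc n)" for x
        using in_E(1,3)[of x] by (cases "x \<in> E") (simp_all add: F_def norm_divide del: of_nat_Suc)
      show "x \<notin> \<Omega> \<Longrightarrow> F x = 0" for x
        using in_E(4)[of x] by (auto simp: F_def)
    qed
    have H: "sq_integrable lebesgue H"
    proof (rule sq_integrable_bounded_support[OF _ \<Omega>_lmeasurable, of _ "real (Suc n)"])
      have "(\<lambda>x. if x \<in> {x. x - a \<in> E} then 1 / g x else 0) \<in> borel_measurable lebesgue"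
        using E' by measurable
      then show "H \<in> borel_measurable lebesgue" unfolding H_def by simp
      show "cmod (H x) \<le> real (Suc n)" for x
        using in_E(1,2,6)[of "x - a"]
        by (cases "x - a \<in> E") (simp_all add: H_def norm_divide del: of_nat_Suc)
      show "x \<notin> \<Omega> \<Longrightarrow> H x = 0" for x
        using in_E(5)[of "x - a"] by (auto simp: H_def)
    qed
    have norms: "(LINT x|lebesgue. (cmod (F x))\<^sup>2) = (LINT x|lebesgue. (cmod (H x))\<^sup>2)"
    proof (rule L2_norm_eq_of_coefficients[OF F _ H])
      show "x \<notin> \<Omega> \<Longrightarrow> F x = 0" for x using in_E(4)[of x] by (auto simp: F_def)
      show "x \<notin> \<Omega> \<Longrightarrow> H x = 0" for x using in_E(5)[of "x - a"] by (auto simp: H_def)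
      fix l
      let ?e = "\<lambda>x. (indicator E x :: complex) * cnj (expo l x)"
      have "(indicator E :: 'a \<Rightarrow> complex) \<in> borel_measurable lebesgue"
        using E by (rule borel_measurable_indicator)
      then have e: "?e \<in> borel_measurable lebesgue"
        by (intro borel_measurable_times borel_measurable_expo(2))
      have Fg: "F x * cnj (expo l x) * complex_of_real (g x) = ?e x" for x
        using in_E(1)[of x] by (cases "x \<in> E") (simp_all add: F_def)
      have Hg: "H x * cnj (expo l x) * complex_of_real (g x) = cnj (expo l a) * ?e (x - a)" for x
        using in_E(1,2)[of "x - a"] expo_add[of l "x - a" a]
        by (cases "x - a \<in> E") (simp_all add: H_def)
      have "(LINT x|lebesgue. ?e (x - a)) = (LINT x|lebesgue. ?e x)"
        using integral_lebesgue_translation[OF e, of "- a"] by simp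
      then show "cmod (LINT x|lebesgue. F x * cnj (expo l x) * complex_of_real (g x)) =
          cmod (LINT x|lebesgue. H x * cnj (expo l x) * complex_of_real (g x))"
        unfolding Fg Hg by (simp only: integral_mult_right_zero norm_mult complex_mod_cnj cmod_expo mult_1)
    qed
    have iF: "integrable lebesgue (\<lambda>x. (cmod (F x))\<^sup>2)" and iH: "integrable lebesgue (\<lambda>x. (cmod (H x))\<^sup>2)"
      using F H by (auto simp: sq_integrable_def)
    have iH': "integrable lebesgue (\<lambda>x. (cmod (H (x + a)))\<^sup>2)"
      by (rule integrable_lebesgue_translation[OF iH])
    have "(LINT x|lebesgue. (cmod (F x))\<^sup>2 - (cmod (H (x + a)))\<^sup>2) = 0"
      using norms iF iH' integral_lebesgue_translation[OF borel_measurable_integrable[OF iH], of a]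
      by simp
    moreover have gap: "(cmod (F x))\<^sup>2 - (cmod (H (x + a)))\<^sup>2 > 0" if x: "x \<in> E" for x
    proof -
      have "1 / g (x + a) < 1 / g x" using in_E[OF x] by (intro divide_strict_left_mono) auto
      moreover have "0 \<le> 1 / g (x + a)" using g_nonneg by simp
      ultimately have "(1 / g (x + a))\<^sup>2 < (1 / g x)\<^sup>2" by (intro power_strict_mono) auto
      then show ?thesis using x by (simp add: F_def H_def norm_divide power_divide)
    qed
    moreover have "(cmod (F x))\<^sup>2 - (cmod (H (x + a)))\<^sup>2 \<ge> 0" for x
    proof (cases "x \<in> E")
      case True
      show ?thesis by (rule less_imp_le[OF gap[OF True]])
    qed (simp add: F_def H_def)
    ultimately have "AE x in lebesgue. (cmod (F x))\<^sup>2 - (cmod (H (x + a)))\<^sup>2 = 0"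
      using integral_nonneg_eq_0_iff_AE[OF Bochner_Integration.integrable_diff[OF iF iH']] by simp
    then show ?thesis
      by eventually_elim (use gap in \<open>force simp: E_def\<close>)
  qed
  then have "AE x in lebesgue. \<forall>n. \<not> (1 / real (Suc n) \<le> g x \<and> g x < g (x + a))"
    by (simp only: AE_all_countable) simp
  then show ?thesis
  proof eventually_elim
    case (elim x)
    show ?case
    proof
      assume x: "0 < g x \<and> g x < g (x + a)"
      then obtain n where "inverse (real (Suc n)) < g x" using reals_Archimedean by blast
      with elim x show False by (auto simp: inverse_eq_divide dest: less_imp_le simp del: of_nat_Suc)
    qed
  qed
qed

lemma window_norm: "(LINT x|lebesgue. (g x)\<^sup>2) = 1"
proof -
  obtain l p where lp: "l \<in> \<Lambda>" "p \<in> J" by (rule indices_nonempty)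
  have "L2_inner lebesgue (gabor g (l, p)) (gabor g (l, p)) = 1"
    using onb(2)[of "(l, p)" "(l, p)"] lp by simp
  then have "(LINT x|lebesgue. (g (x - p))\<^sup>2) = 1"
    by (simp add: L2_inner_self gabor_def norm_mult)
  then show ?thesis
    using integral_lebesgue_translation[OF borel_measurable_integrable[OF g_sq], of "- p"] by simp
qed

definition \<kappa> :: real where "\<kappa> = (measure lebesgue \<Omega>) powr (-1/2)"

lemma \<kappa>_pos: "\<kappa> > 0"
  using \<Omega>_pos by (simp add: \<kappa>_def)

lemma \<kappa>_square: "\<kappa>\<^sup>2 * measure lebesgue \<Omega> = 1"
proof -
  have "\<kappa>\<^sup>2 = measure lebesgue \<Omega> powr (-1)"
    using \<Omega>_pos by (simp add: \<kappa>_def power2_eq_square flip: powr_add)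
  then show ?thesis using \<Omega>_pos by (simp add: powr_minus)
qed

lemma window_const: "AE x in lebesgue. g x = \<kappa> * indicator \<Omega> x"
proof -
  let ?A = "{x. 0 < g x \<and> g x \<le> \<kappa>}" and ?B = "{x. \<kappa> < g x}"
  have [measurable]: "g \<in> borel_measurable lebesgue" by (rule g_meas)
  have "{x \<in> space lebesgue. 0 < g x \<and> g x \<le> \<kappa>} \<in> sets lebesgue"
    "{x \<in> space lebesgue. \<kappa> < g x} \<in> sets lebesgue" by measurable
  then have sets: "?A \<in> sets lebesgue" "?B \<in> sets lebesgue" by simp_all
  have "?A \<in> null_sets lebesgue \<or> ?B \<in> null_sets lebesgue"
  proof (rule null_sets_dichotomy_translation[OF sets])
    show "AE x in lebesgue. \<not> (x \<in> ?A \<and> x + a \<in> ?B)" for a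
      using AE_not_less_translate[of a] by eventually_elim auto
  qed
  then have cases: "(AE x in lebesgue. x \<notin> ?A) \<or> (AE x in lebesgue. x \<notin> ?B)"
    using AE_iff_null_sets[OF sets(1)] AE_iff_null_sets[OF sets(2)] by blast
  have ind: "integrable lebesgue (\<lambda>x. \<kappa>\<^sup>2 * indicator \<Omega> x :: real)"
    using \<Omega>_meas fmeasurableD2[OF \<Omega>_lmeasurable]
    by (intro integrable_mult_right integrable_real_indicator) (auto simp: less_top)
  have int: "(LINT x|lebesgue. \<kappa>\<^sup>2 * indicator \<Omega> x) = 1"
    using \<kappa>_square by simp
  have eq: "AE x in lebesgue. (g x)\<^sup>2 = \<kappa>\<^sup>2 * indicator \<Omega> x"
    using cases
  proof
    assume "AE x in lebesgue. x \<notin> ?A"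
    then have "AE x in lebesgue. 0 \<le> (g x)\<^sup>2 - \<kappa>\<^sup>2 * indicator \<Omega> x"
      using g_pos
    proof eventually_elim
      case (elim x)
      show ?case
      proof (cases "x \<in> \<Omega>")
        case True
        with elim have "\<kappa> \<le> g x" by auto
        then have "\<kappa>\<^sup>2 \<le> (g x)\<^sup>2" using \<kappa>_pos by (intro power_mono) auto
        then show ?thesis using True by simp
      qed simp
    qed
    from integral_nonneg_eq_0_iff_AE[OF Bochner_Integration.integrable_diff[OF g_sq ind] this]
    have "AE x in lebesgue. (g x)\<^sup>2 - \<kappa>\<^sup>2 * indicator \<Omega> x = 0"
      by (simp only: Bochner_Integration.integral_diff[OF g_sq ind] window_norm int diff_self simp_thms)
    then show ?thesis by eventually_elim simp
  next
    assume "AE x in lebesgue. x \<notin> ?B"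
    then have "AE x in lebesgue. 0 \<le> \<kappa>\<^sup>2 * indicator \<Omega> x - (g x)\<^sup>2"
    proof eventually_elim
      case (elim x)
      show ?case
      proof (cases "x \<in> \<Omega>")
        case True
        from elim have "(g x)\<^sup>2 \<le> \<kappa>\<^sup>2" using g_nonneg by (intro power_mono) auto
        then show ?thesis using True by simp
      qed (simp add: g_supp)
    qed
    from integral_nonneg_eq_0_iff_AE[OF Bochner_Integration.integrable_diff[OF ind g_sq] this]
    have "AE x in lebesgue. \<kappa>\<^sup>2 * indicator \<Omega> x - (g x)\<^sup>2 = 0"
      by (simp only: Bochner_Integration.integral_diff[OF ind g_sq] window_norm int diff_self simp_thms)
    then show ?thesis by eventually_elim simp
  qed
  then show ?thesis
  proof eventually_elim
    case (elim x)
    show ?case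
    proof (cases "x \<in> \<Omega>")
      case True
      with elim have "(g x)\<^sup>2 = \<kappa>\<^sup>2" by simp
      then show ?thesis using True g_nonneg[of x] \<kappa>_pos by (simp add: power2_eq_iff_nonneg)
    qed (simp add: g_supp)
  qed
qed

lemma L2_inner_restrict:
  "L2_inner (restrict_space lebesgue \<Omega>) f h = (LINT x|lebesgue. indicator \<Omega> x *\<^sub>R (f x * cnj (h x)))"
  unfolding L2_inner_def using \<Omega>_meas by (intro integral_restrict_space) simp

lemma sq_integrable_restrict:
  "sq_integrable (restrict_space lebesgue \<Omega>) f \<longleftrightarrow> sq_integrable lebesgue (\<lambda>x. indicator \<Omega> x *\<^sub>R f x)"
proof -
  have \<Omega>: "\<Omega> \<inter> space lebesgue \<in> sets lebesgue" using \<Omega>_meas by simp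
  have "(cmod (indicator \<Omega> x *\<^sub>R f x))\<^sup>2 = indicator \<Omega> x *\<^sub>R (cmod (f x))\<^sup>2" for x
    by (simp add: indicator_def)
  then show ?thesis
    unfolding sq_integrable_def borel_measurable_restrict_space_iff[OF \<Omega>] integrable_restrict_space[OF \<Omega>]
    by simp
qed

lemma spectrum: "L2_orthogonal_basis (restrict_space lebesgue \<Omega>) \<Lambda> expo"
  unfolding L2_orthogonal_basis_def
proof (intro conjI ballI allI impI)
  obtain p where p: "p \<in> J" by (rule indices_nonempty)
  fix l assume l: "l \<in> \<Lambda>"
  show "sq_integrable (restrict_space lebesgue \<Omega>) (expo l)"
    unfolding sq_integrable_restrict
  proof (rule sq_integrable_bounded_support[OF _ \<Omega>_lmeasurable, of _ 1])
    show "(\<lambda>x. indicator \<Omega> x *\<^sub>R expo l x) \<in> borel_measurable lebesgue"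
      using \<Omega>_meas borel_measurable_expo(1)[of l] by (intro borel_measurable_scaleR borel_measurable_indicator)
  qed (auto simp: indicator_def)
  show "\<not> (AE x in restrict_space lebesgue \<Omega>. expo l x = 0)"
  proof
    have nz: "expo l x \<noteq> 0" for x by (simp add: expo_def)
    assume "AE x in restrict_space lebesgue \<Omega>. expo l x = 0"
    then have "AE x in lebesgue. x \<notin> \<Omega>"
      using \<Omega>_meas by (subst (asm) AE_restrict_space_iff) (auto simp: nz)
    then show False using not_AE_notin_\<Omega> by simp
  qed
  fix l' assume l': "l' \<in> \<Lambda>" "l \<noteq> l'"
  let ?F = "\<lambda>x. expo l x * complex_of_real (g x)"
  have gm: "g \<in> borel_measurable lebesgue" by (rule g_meas)
  have F: "?F \<in> borel_measurable lebesgue"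
    using gm borel_measurable_expo(1)[of l] by measurable
  have "L2_inner lebesgue (gabor g (l, p)) (gabor g (l', p)) = 0"
    using onb(2)[of "(l, p)" "(l', p)"] l l' p by simp
  moreover have "gabor g (l, p) = (\<lambda>x. expo l p * ?F (x - p))"
    using expo_add[of l _ p] by (auto simp: gabor_def fun_eq_iff) (metis diff_add_cancel mult.commute)
  ultimately have "expo l p * L2_inner lebesgue (\<lambda>x. ?F (x - p)) (gabor g (l', p)) = 0"
    by (simp add: L2_inner_def mult.assoc)
  then have "(LINT x|lebesgue. ?F x * cnj (expo l' x) * complex_of_real (g x)) = 0"
    unfolding coefficient_same[OF F] by (simp add: expo_def)
  also have "(LINT x|lebesgue. ?F x * cnj (expo l' x) * complex_of_real (g x)) =
    (LINT x|lebesgue. complex_of_real (\<kappa>\<^sup>2) * (indicator \<Omega> x *\<^sub>R (expo l x * cnj (expo l' x))))"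
  proof (rule integral_cong_AE)
    show "(\<lambda>x. ?F x * cnj (expo l' x) * complex_of_real (g x)) \<in> borel_measurable lebesgue"
      using F gm borel_measurable_expo(2)[of l'] by measurable
    show "(\<lambda>x. complex_of_real (\<kappa>\<^sup>2) * (indicator \<Omega> x *\<^sub>R (expo l x * cnj (expo l' x)))) \<in> borel_measurable lebesgue"
      using \<Omega>_meas borel_measurable_expo(1)[of l] borel_measurable_expo(2)[of l'] by measurable
    show "AE x in lebesgue. ?F x * cnj (expo l' x) * complex_of_real (g x) =
        complex_of_real (\<kappa>\<^sup>2) * (indicator \<Omega> x *\<^sub>R (expo l x * cnj (expo l' x)))"
      using window_const by eventually_elim (simp add: indicator_def power2_eq_square)
  qed
  finally have "complex_of_real (\<kappa>\<^sup>2) * (LINT x|lebesgue. indicator \<Omega> x *\<^sub>R (expo l x * cnj (expo l' x))) = 0"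
    by (simp only: integral_mult_right_zero)
  then show "L2_inner (restrict_space lebesgue \<Omega>) (expo l) (expo l') = 0"
    using \<kappa>_pos unfolding L2_inner_restrict by simp
next
  obtain p where p: "p \<in> J" by (rule indices_nonempty)
  fix f assume f: "sq_integrable (restrict_space lebesgue \<Omega>) f \<and>
    (\<forall>l\<in>\<Lambda>. L2_inner (restrict_space lebesgue \<Omega>) f (expo l) = 0)"
  let ?F = "\<lambda>x. indicator \<Omega> x *\<^sub>R f x"
  have F: "sq_integrable lebesgue ?F" using f by (simp add: sq_integrable_restrict)
  have "L2_inner lebesgue (\<lambda>x. ?F (x - p)) (gabor g i) = 0" if "i \<in> \<Lambda> \<times> J" for i
  proof -
    from that obtain l p' where i: "i = (l, p')" "l \<in> \<Lambda>" "p' \<in> J" by auto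
    show ?thesis
    proof (cases "p' = p")
      case True
      have Fm: "?F \<in> borel_measurable lebesgue" by (rule sq_integrable_measurable[OF F])
      have "(LINT x|lebesgue. ?F x * cnj (expo l x) * complex_of_real (g x)) =
        (LINT x|lebesgue. complex_of_real \<kappa> * (indicator \<Omega> x *\<^sub>R (f x * cnj (expo l x))))"
      proof (rule integral_cong_AE)
        have gm: "g \<in> borel_measurable lebesgue" by (rule g_meas)
        show "(\<lambda>x. ?F x * cnj (expo l x) * complex_of_real (g x)) \<in> borel_measurable lebesgue"
          using Fm gm borel_measurable_expo(2)[of l] by measurable
        have "(\<lambda>x. complex_of_real \<kappa> * (?F x * cnj (expo l x))) \<in> borel_measurable lebesgue"
          using Fm borel_measurable_expo(2)[of l] by measurable
        then show "(\<lambda>x. complex_of_real \<kappa> * (indicator \<Omega> x *\<^sub>R (f x * cnj (expo l x)))) \<in> borel_measurable lebesgue"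
          by simp
        show "AE x in lebesgue. ?F x * cnj (expo l x) * complex_of_real (g x) =
            complex_of_real \<kappa> * (indicator \<Omega> x *\<^sub>R (f x * cnj (expo l x)))"
          using window_const by eventually_elim (simp add: indicator_def)
      qed
      also have "\<dots> = complex_of_real \<kappa> * (LINT x|lebesgue. indicator \<Omega> x *\<^sub>R (f x * cnj (expo l x)))"
        by (rule integral_mult_right_zero)
      also have "\<dots> = 0"
        using f i(2) unfolding L2_inner_restrict by simp
      finally show ?thesis using coefficient_same[OF Fm, of p l] True i by simp
    next
      case False
      then show ?thesis
        using coefficient_other[OF p i(3), of ?F l] i by simp
    qed
  qed
  then have "AE x in lebesgue. ?F (x - p) = 0"
    by (intro onb(3)[OF sq_integrable_translation[OF F]])
  from AE_lebesgue_translation[OF this, of p] have "AE x in lebesgue. ?F x = 0" by simp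
  then have "AE x in lebesgue. x \<in> \<Omega> \<longrightarrow> f x = 0" by eventually_elim (auto simp: indicator_def)
  then show "AE x in restrict_space lebesgue \<Omega>. f x = 0"
    using \<Omega>_meas by (subst AE_restrict_space_iff) simp_all
qed

end

theorem theorem6p2:
  fixes g :: "'a::euclidean_space \<Rightarrow> real"
    and \<Omega> \<Lambda> J :: "'a set"
  assumes g_L2: "g \<in> borel_measurable lebesgue" "integrable lebesgue (\<lambda>x. (g x)\<^sup>2)"
    and g_nonneg: "\<And>x. g x \<ge> 0"
    and g_supp: "\<And>x. x \<notin> \<Omega> \<Longrightarrow> g x = 0"
    and \<Omega>_meas: "\<Omega> \<in> sets lebesgue"
    and \<Omega>_bdd: "bounded \<Omega>"
    and \<Omega>_pos: "measure lebesgue \<Omega> > 0"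
    and g_pos: "AE x in lebesgue. x \<in> \<Omega> \<longrightarrow> g x > 0"
    and \<Lambda>_discrete: "discrete \<Lambda>"
    and J_discrete: "discrete J"
    and ONB: "L2_orthonormal_basis lebesgue (\<Lambda> \<times> J) (gabor g)"
  shows "tiling_set \<Omega> J \<and>
         (AE x in lebesgue. g x = (measure lebesgue \<Omega>) powr (-1/2) * indicator \<Omega> x) \<and>
         L2_orthogonal_basis (restrict_space lebesgue \<Omega>) \<Lambda> expo"
proof -
  interpret gabor_basis g \<Omega> \<Lambda> J
    by unfold_locales (fact assms)+
  show ?thesis
    using tiling[OF countable_discrete[OF J_discrete]] window_const spectrum
    unfolding \<kappa>_def by blast
qed

end
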